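(* Let $n,m,l\in\mathbb{N}$ with $1\le m\le n-1$ and $m+1\le l\le n-1$, and let $(M_{m,n-l}(t),N_{m,l-m}(t))$ be a Luchko pair of kernels from the subset $T_{n,m,l}\subset L_n$. Then, for the general fractional derivative $D_{(N)}$ of Riemann-Liouville type and the general fractional integral $I_{(M)}$ associated with this pair, the equality $$I_{(M)} D_{(N)} X(t) = X(t)$$ holds (for $t>0$) for every $X(t)\in C_{-1,(M)}(0,\infty)$, where $$C_{-1,(M)}(0,\infty) := \{X:\ X(t) = I_{(M)}Y(t) = (M_{m,n-l} * Y)(t),\ Y(t)\in C_{-1}(0,\infty)\}.$$
   Context: $C_{-1}(0,\infty)$ is the space of functions $f$ on $(0,\infty)$ that can be represented as $f(t)=t^p g(t)$ for $t>0$ with some $p>-1$ and $g\in C[0,\infty)$. $C_{-1,0}(0,\infty)$ is the space of functions $f$ on $(0,\infty)$ that can be represented as $f(t)=t^p g(t)$ for $t>0$ with some $-1<p<0$ and $g\in C[0,\infty)$. The symbol $*$ denotes the Laplace convolution $(f*g)(t)=\int_0^t f(t-\tau)g(\tau)\,d\tau$, $t>0$. $\{1\}$ is the function identically equal to $1$, and for $n\in\mathbb{N}$, $\{1\}^n$ is its $n$-fold convolution power, $\{1\}^n=h_n(t)=\frac{t^{n-1}}{(n-1)!}$. For $n\in\mathbb{N}$, the Luchko set $L_n$ is the set of pairs $(M(t),N(t))$ (Luchko pairs) with $M,N\in C_{-1}(0,\infty)$ such that $(M*N)(t)=\{1\}^n$ for all $t\in(0,\infty)$. A Sonine pair is a pair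 $(\mu(t),\nu(t))$ with $\mu,\nu\in C_{-1,0}(0,\infty)$ and $(\mu*\nu)(t)=\{1\}$ for all $t\in(0,\infty)$; Sonine pairs belong to $L_1$. $T_m$ is the subset of $L_m$ consisting of the pairs in $L_m$ of the form $(\mu_1*\ldots*\mu_m,\ \nu_1*\ldots*\nu_m)$, where $(\mu_k,\nu_k)$ are Sonine pairs from $L_1$ for all $k=1,\dots,m$. $T_{n,m,l}$ is the subset of $L_n$ consisting of the pairs in $L_n$ of the form $$M_{m,n-l}(t)=(\{1\}^{n-l}*M_m)(t),\quad N_{m,l-m}(t)=(\{1\}^{l-m}*N_m)(t)$$ with $(M_m(t),N_m(t))\in T_m$. For $(M_{m,n-l},N_{m,l-m})\in T_{n,m,l}$: the general fractional integral is $I_{(M)}X(t)=(M_{m,n-l}*X)(t)=\int_0^t M_{m,n-l}(t-\tau)X(\tau)\,d\tau$ for $X\in C_{-1}(0,\infty)$; the general fractional derivative of Riemann-Liouville type is $D_{(N)}X(t)=\frac{d^n}{dt^n}(N_{m,l-m}*X)(t)=\frac{d^n}{dt^n}\int_0^t N_{m,l-m}(t-\tau)X(\tau)\,d\tau$ for $X\in C_{-1}(0,\infty)$. *)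

theory Defs
  imports "HOL-Analysis.Analysis"
begin

text \<open>
  Functions on the open half-line are modelled as total functions of type
  \<open>real \<Rightarrow> real\<close> whose values at points \<open>t \<le> 0\<close> are never inspected: membership
  conditions and equalities are required only for \<open>t > 0\<close>, and convolutions integrate over
  an open interval.
\<close>

definition C_minus1 :: "(real \<Rightarrow> real) set" where
  "C_minus1 = {f. \<exists>p g. p > -1 \<and> continuous_on {0..} g \<and> (\<forall>t>0. f t = t powr p * g t)}"

definition C_minus1_0 :: "(real \<Rightarrow> real) set" where
  "C_minus1_0 = {f. \<exists>p g. -1 < p \<and> p < 0 \<and> continuous_on {0..} g \<and> (\<forall>t>0. f t = t powr p * g t)}"

definition lconv :: "(real \<Rightarrow> real) \<Rightarrow> (real \<Rightarrow> real) \<Rightarrow> real \<Rightarrow> real"  (infixl \<open>\<star>\<close> 70) where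
  "(f \<star> g) t = (LINT \<tau>:{0<..<t}|lborel. f (t - \<tau>) * g \<tau>)"

text \<open>
  \<open>lconv_seq f m\<close> is the iterated convolution of \<open>f 1, \<dots>, f m\<close>. It is left unspecified for
  \<open>m = 0\<close>, because the convolution has no neutral element among functions.
\<close>

fun lconv_seq :: "(nat \<Rightarrow> real \<Rightarrow> real) \<Rightarrow> nat \<Rightarrow> real \<Rightarrow> real" where
  "lconv_seq f (Suc 0) = f 1"
| "lconv_seq f (Suc (Suc k)) = lconv_seq f (Suc k) \<star> f (Suc (Suc k))"

definition one_pow :: "nat \<Rightarrow> real \<Rightarrow> real" where
  "one_pow n = lconv_seq (\<lambda>_ _. 1) n"

lemma one_pow_eq:
  assumes "n \<ge> 1" "t > 0"
  shows "one_pow n t = t ^ (n - 1) / fact (n - 1)"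
proof -
  have "lconv_seq (\<lambda>_ _. 1) (Suc k) t = t ^ k / fact k" if "t > 0" for k and t :: real
    using that
  proof (induction k arbitrary: t)
    case 0
    then show ?case by simp
  next
    case (Suc k)
    have "lconv_seq (\<lambda>_ _. 1) (Suc (Suc k)) t
          = (LINT \<tau>:{0<..<t}|lborel. lconv_seq (\<lambda>_ _. 1) (Suc k) (t - \<tau>))"
      by (simp add: lconv_def)
    also have "\<dots> = (LINT \<tau>:{0<..<t}|lborel. (t - \<tau>) ^ k / fact k)"
      using Suc.IH by (intro set_lebesgue_integral_cong) auto
    also have "\<dots> = (LBINT \<tau>=ereal 0..ereal t. (t - \<tau>) ^ k / fact k)"
      using Suc.prems by (simp add: interval_lebesgue_integral_def einterval_eq del: zero_ereal_def)
    also have "\<dots> = - ((t - t) ^ Suc k / fact (Suc k)) - (- ((t - 0) ^ Suc k / fact (Suc k)))"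
    proof (rule interval_integral_FTC_finite)
      show "continuous_on {min 0 t..max 0 t} (\<lambda>\<tau>. (t - \<tau>) ^ k / fact k)"
        by (intro continuous_intros) auto
    next
      fix x
      have "((\<lambda>\<tau>. - ((t - \<tau>) ^ Suc k / fact (Suc k))) has_real_derivative
              (1 + real k) * (t - x) ^ k / fact (Suc k)) (at x within {min 0 t..max 0 t})"
        by (auto intro!: derivative_eq_intros simp del: power_Suc fact_Suc)
      moreover have "(1 + real k) * (t - x) ^ k / fact (Suc k) = (t - x) ^ k / fact k"
        by (simp add: divide_simps)
      ultimately show "((\<lambda>\<tau>. - ((t - \<tau>) ^ Suc k / fact (Suc k))) has_vector_derivative
              (t - x) ^ k / fact k) (at x within {min 0 t..max 0 t})"
        by (simp add: has_real_derivative_iff_has_vector_derivative del: power_Suc fact_Suc)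
    qed
    finally show ?case by simp
  qed
  from this[of t "n - 1"] assms show ?thesis
    by (simp add: one_pow_def)
qed

definition luchko_set :: "nat \<Rightarrow> ((real \<Rightarrow> real) \<times> (real \<Rightarrow> real)) set" where
  "luchko_set n = {(M, N). M \<in> C_minus1 \<and> N \<in> C_minus1 \<and> (\<forall>t>0. (M \<star> N) t = one_pow n t)}"

definition sonine_pairs :: "((real \<Rightarrow> real) \<times> (real \<Rightarrow> real)) set" where
  "sonine_pairs = {(\<mu>, \<nu>). \<mu> \<in> C_minus1_0 \<and> \<nu> \<in> C_minus1_0 \<and> (\<forall>t>0. (\<mu> \<star> \<nu>) t = 1)}"

definition luchko_T :: "nat \<Rightarrow> ((real \<Rightarrow> real) \<times> (real \<Rightarrow> real)) set" where
  "luchko_T m = {(M, N) \<in> luchko_set m. \<exists>\<mu> \<nu>.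
      (\<forall>k\<in>{1..m}. (\<mu> k, \<nu> k) \<in> sonine_pairs) \<and>
      (\<forall>t>0. M t = lconv_seq \<mu> m t) \<and> (\<forall>t>0. N t = lconv_seq \<nu> m t)}"

definition luchko_T3 :: "nat \<Rightarrow> nat \<Rightarrow> nat \<Rightarrow> ((real \<Rightarrow> real) \<times> (real \<Rightarrow> real)) set" where
  "luchko_T3 n m l = {(M, N) \<in> luchko_set n. \<exists>(Mm, Nm) \<in> luchko_T m.
      (\<forall>t>0. M t = (one_pow (n - l) \<star> Mm) t) \<and> (\<forall>t>0. N t = (one_pow (l - m) \<star> Nm) t)}"

definition gfi :: "(real \<Rightarrow> real) \<Rightarrow> (real \<Rightarrow> real) \<Rightarrow> real \<Rightarrow> real" where
  "gfi M X = M \<star> X"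

definition gfd_RL :: "nat \<Rightarrow> (real \<Rightarrow> real) \<Rightarrow> (real \<Rightarrow> real) \<Rightarrow> real \<Rightarrow> real" where
  "gfd_RL n N X = (deriv ^^ n) (N \<star> X)"

text \<open>
  Since \<^const>\<open>deriv\<close> is total, a separate predicate records that the iterated derivative in
  \<^const>\<open>gfd_RL\<close> genuinely exists on the open half-line.
\<close>

definition gfd_RL_exists :: "nat \<Rightarrow> (real \<Rightarrow> real) \<Rightarrow> (real \<Rightarrow> real) \<Rightarrow> bool" where
  "gfd_RL_exists n N X \<longleftrightarrow> (\<forall>k<n. \<forall>t>0. (deriv ^^ k) (N \<star> X) field_differentiable (at t))"

definition C_minus1_gfi :: "(real \<Rightarrow> real) \<Rightarrow> (real \<Rightarrow> real) set" where
  "C_minus1_gfi M = {X. \<exists>Y\<in>C_minus1. \<forall>t>0. X t = gfi M Y t}"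

end

theory Submission
  imports Defs
begin

text \<open>
  Write \<open>X = M \<star> Y\<close>. The defining identity of a Luchko pair, \<open>M \<star> N = {1}\<^sup>n\<close>, gives
  \<open>N \<star> X = (N \<star> M) \<star> Y = {1}\<^sup>n \<star> Y\<close>, which is the \<open>n\<close>-fold integral of \<open>Y\<close> from \<open>0\<close>.
  Differentiating \<open>n\<close> times returns \<open>Y\<close>, because \<open>Y\<close> is continuous on the open half-line; hence
  the derivative of \<open>X\<close> is \<open>Y\<close>, and applying \<open>M \<star> _\<close> to it gives \<open>X\<close> back. The lemma
  \<open>gfd_RL_gfi\<close> carries this out for an arbitrary Luchko pair.

  The analytic content lies in two facts about functions that are continuous for \<open>t > 0\<close> and
  have an integrable power singularity at \<open>0\<close>. Convolution of such functions is associative at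
  \<^emph>\<open>every\<close> \<open>t\<close>, not merely almost everywhere (\<open>lconv_assoc\<close>): on a bounded interval each factor is
  dominated by a power \<open>u\<^sup>p\<close> with \<open>p > -1\<close>, and by the Beta integral such powers are closed under
  convolution, which provides the integrability for Fubini's theorem. And convolution with the
  constant \<open>1\<close> is a primitive that stays in the same class (\<open>lconv_one_C_minus1\<close>,
  \<open>lconv_one_deriv\<close>), so the primitives can be peeled off one derivative at a time
  (\<open>one_pow_lconv_deriv\<close>).
\<close>

section \<open>Convolution as an integral over the whole line\<close>

text \<open>
  Cutting functions off at zero turns the variable limits of the Laplace convolution into an
  integral over the whole line, where translation invariance and Fubini's theorem apply without
  case distinctions on the limits.
\<close>

definition zero_ext :: "(real \<Rightarrow> real) \<Rightarrow> real \<Rightarrow> real" where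
  "zero_ext f u = (if 0 < u then f u else 0)"

lemma lconv_zero_ext: "(f \<star> g) t = (\<integral>\<tau>. zero_ext f (t - \<tau>) * zero_ext g \<tau> \<partial>lborel)"
  unfolding lconv_def set_lebesgue_integral_def
  by (intro Bochner_Integration.integral_cong) (auto simp: zero_ext_def)

lemma zero_ext_lconv: "zero_ext (f \<star> g) t = (f \<star> g) t"
proof (cases "t > 0")
  case False
  then have "(f \<star> g) t = (\<integral>\<tau>. 0 \<partial>(lborel :: real measure))"
    unfolding lconv_zero_ext by (intro Bochner_Integration.integral_cong) (auto simp: zero_ext_def)
  with False show ?thesis by (simp add: zero_ext_def)
qed (simp add: zero_ext_def)

lemma lconv_commute: "(f \<star> g) t = (g \<star> f) t"
proof -
  have "(f \<star> g) t = (\<integral>\<tau>. zero_ext f (t - (t + (-1) * \<tau>)) * zero_ext g (t + (-1) * \<tau>) \<partial>lborel)"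
    unfolding lconv_zero_ext
    by (subst lborel_integral_real_affine[where c = "-1" and t = t]) auto
  also have "\<dots> = (g \<star> f) t"
    unfolding lconv_zero_ext by (simp add: mult.commute)
  finally show ?thesis .
qed

lemma zero_ext_cong:
  assumes "\<And>t. t > 0 \<Longrightarrow> f t = f' t"
  shows "zero_ext f = zero_ext f'"
  using assms by (auto simp: zero_ext_def)

lemma lconv_cong:
  assumes "\<And>t. t > 0 \<Longrightarrow> f t = f' t" and "\<And>t. t > 0 \<Longrightarrow> g t = g' t"
  shows "f \<star> g = f' \<star> g'"
  by (intro ext) (simp only: lconv_zero_ext zero_ext_cong[OF assms(1)] zero_ext_cong[OF assms(2)])

section \<open>Power kernels\<close>

abbreviation pow_kernel :: "real \<Rightarrow> real \<Rightarrow> real" where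
  "pow_kernel p \<equiv> zero_ext (\<lambda>u. u powr p)"

lemma pow_kernel_nonneg [simp]: "0 \<le> pow_kernel p u"
  by (simp add: zero_ext_def)

lemma measurable_pow_kernel [measurable]: "pow_kernel p \<in> borel_measurable borel"
  unfolding zero_ext_def[abs_def] by measurable

text \<open>
  For \<open>s > 0\<close> the substitution \<open>\<tau> = s x\<close> pulls out the factor \<open>s\<^bsup>p + q + 1\<^esup>\<close> and leaves Euler's
  Beta integral. The exponent \<open>p + q + 1\<close> is again greater than \<open>-1\<close>, so the estimate can be
  applied a second time to a threefold convolution.
\<close>

lemma pow_kernel_conv:
  assumes "p > -1" and "q > -1"
  shows "(\<integral>\<^sup>+\<tau>. ennreal (pow_kernel p (s - \<tau>) * pow_kernel q \<tau>) \<partial>lborel)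
         = ennreal (Beta (q + 1) (p + 1) * pow_kernel (p + q + 1) s)"
proof (cases "s > 0")
  case False
  then have "pow_kernel p (s - \<tau>) * pow_kernel q \<tau> = 0" for \<tau>
    by (auto simp: zero_ext_def)
  then have "(\<integral>\<^sup>+\<tau>. ennreal (pow_kernel p (s - \<tau>) * pow_kernel q \<tau>) \<partial>lborel) = 0"
    by (simp only: ennreal_0 nn_integral_const mult_zero_left)
  then show ?thesis using False by (simp add: zero_ext_def)
next
  case True
  let ?b = "\<lambda>x. x powr q * (1 - x) powr p"
  have scale: "pow_kernel p (s - s * x) * pow_kernel q (s * x)
      = s powr (p + q) * (?b x * indicator {0<..<1} x)" for x
  proof (cases "x \<in> {0<..<1}")
    case True
    have "pow_kernel p (s - s * x) = (s * (1 - x)) powr p"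
      using \<open>s > 0\<close> True by (simp add: zero_ext_def algebra_simps)
    then show ?thesis using \<open>s > 0\<close> True
      by (simp add: zero_ext_def powr_mult powr_add)
  next
    case False
    then have "s * x \<le> 0 \<or> s - s * x \<le> 0"
      using \<open>s > 0\<close> by (auto simp: mult_le_0_iff not_less)
    with False show ?thesis by (auto simp: zero_ext_def)
  qed
  have beta: "(\<integral>\<^sup>+x. ennreal (?b x * indicator {0<..<1} x) \<partial>lborel)
      = ennreal (Beta (q + 1) (p + 1))"
  proof -
    have "(?b has_integral Beta (q + 1) (p + 1)) {0<..<1}"
      using has_integral_Beta_real[of "q + 1" "p + 1"] assms
      by (simp add: has_integral_Icc_iff_Ioo)
    from nn_integral_has_integral_lebesgue[OF _ this] show ?thesis
      by (simp add: mult.commute)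
  qed
  have "(\<integral>\<^sup>+\<tau>. ennreal (pow_kernel p (s - \<tau>) * pow_kernel q \<tau>) \<partial>lborel)
      = ennreal s * (\<integral>\<^sup>+x. ennreal (pow_kernel p (s - s * x) * pow_kernel q (s * x)) \<partial>lborel)"
    using \<open>s > 0\<close> by (subst nn_integral_real_affine[where c = s and t = 0]) auto
  also have "\<dots> = ennreal s * (\<integral>\<^sup>+x. ennreal (s powr (p + q)) *
                    ennreal (?b x * indicator {0<..<1} x) \<partial>lborel)"
    by (simp only: scale ennreal_mult'[OF powr_ge_zero])
  also have "\<dots> = ennreal s * (ennreal (s powr (p + q)) * ennreal (Beta (q + 1) (p + 1)))"
    by (subst nn_integral_cmult) (auto simp: beta)
  also have "\<dots> = ennreal (Beta (q + 1) (p + 1) * pow_kernel (p + q + 1) s)"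
    using \<open>s > 0\<close>
    by (simp add: zero_ext_def powr_add ennreal_mult' mult_ac)
  finally show ?thesis .
qed

section \<open>Associativity for functions with an integrable power singularity\<close>

lemma C_minus1_cong:
  assumes "f \<in> C_minus1" and "\<And>t. t > 0 \<Longrightarrow> f t = f' t"
  shows "f' \<in> C_minus1"
proof -
  from assms(1) obtain p g where "p > -1" "continuous_on {0..} g" "\<forall>t>0. f t = t powr p * g t"
    unfolding C_minus1_def by auto
  moreover from this have "\<forall>t>0. f' t = t powr p * g t"
    using assms(2) by simp
  ultimately show ?thesis
    unfolding C_minus1_def by blast
qed

lemma continuous_on_C_minus1:
  assumes "f \<in> C_minus1"
  shows "continuous_on {0<..} f"
proof -
  from assms obtain p g where g: "continuous_on {0..} g" and f: "\<forall>t>0. f t = t powr p * g t"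
    unfolding C_minus1_def by auto
  have "continuous_on {0<..} (\<lambda>t. t powr p * g t)"
    by (intro continuous_intros continuous_on_subset[OF g]) auto
  then show ?thesis
    by (rule continuous_on_eq) (use f in auto)
qed

lemma measurable_zero_ext:
  assumes "f \<in> C_minus1"
  shows "zero_ext f \<in> borel_measurable borel"
proof -
  have "(\<lambda>u. indicator {0<..} u *\<^sub>R f u) \<in> borel_measurable borel"
    by (rule borel_measurable_continuous_on_indicator) (use continuous_on_C_minus1[OF assms] in auto)
  moreover have "(\<lambda>u. indicator {0<..} u *\<^sub>R f u) = zero_ext f"
    by (auto simp: zero_ext_def)
  ultimately show ?thesis by simp
qed

text \<open>
  The continuous factor is bounded only on bounded intervals, so the constant depends on \<open>T\<close>.
  This is enough: a convolution at \<open>t\<close> only sees arguments up to \<open>t\<close>.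
\<close>

lemma C_minus1_bound:
  assumes "f \<in> C_minus1"
  obtains p C where "p > -1" "C \<ge> 0" "\<And>u. u \<le> T \<Longrightarrow> \<bar>zero_ext f u\<bar> \<le> C * pow_kernel p u"
proof -
  from assms obtain p g where p: "p > -1" and g: "continuous_on {0..} g"
    and f: "\<forall>t>0. f t = t powr p * g t"
    unfolding C_minus1_def by auto
  have "bounded (g ` {0..T})"
    by (intro compact_imp_bounded compact_continuous_image continuous_on_subset[OF g]) auto
  then obtain C where C: "C > 0" "\<And>u. u \<in> {0..T} \<Longrightarrow> \<bar>g u\<bar> \<le> C"
    unfolding bounded_pos by (auto simp: real_norm_def)
  have "\<bar>zero_ext f u\<bar> \<le> C * pow_kernel p u" if "u \<le> T" for u
    using C(2)[of u] that f by (auto simp: zero_ext_def abs_mult mult.commute intro: mult_left_mono)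
  then show ?thesis using that[of p C] p C by auto
qed

lemma integrable_lconv:
  assumes f: "f \<in> C_minus1" and g: "g \<in> C_minus1"
  shows "integrable lborel (\<lambda>\<tau>. zero_ext f (t - \<tau>) * zero_ext g \<tau>)"
proof -
  note [measurable] = measurable_zero_ext[OF f] measurable_zero_ext[OF g]
  obtain p C where p: "p > -1" "C \<ge> 0" "\<And>u. u \<le> t \<Longrightarrow> \<bar>zero_ext f u\<bar> \<le> C * pow_kernel p u"
    using C_minus1_bound[OF f] by blast
  obtain q D where q: "q > -1" "D \<ge> 0" "\<And>u. u \<le> t \<Longrightarrow> \<bar>zero_ext g u\<bar> \<le> D * pow_kernel q u"
    using C_minus1_bound[OF g] by blast
  have bound: "\<bar>zero_ext f (t - \<tau>) * zero_ext g \<tau>\<bar>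
      \<le> (C * D) * (pow_kernel p (t - \<tau>) * pow_kernel q \<tau>)" for \<tau>
  proof (cases "0 < \<tau> \<and> \<tau> < t")
    case True
    then have "\<bar>zero_ext f (t - \<tau>)\<bar> * \<bar>zero_ext g \<tau>\<bar>
        \<le> (C * pow_kernel p (t - \<tau>)) * (D * pow_kernel q \<tau>)"
      using p q by (intro mult_mono) auto
    then show ?thesis by (simp add: abs_mult mult_ac)
  qed (auto simp: zero_ext_def)
  show ?thesis
  proof (rule Bochner_Integration.integrable_bound)
    show "integrable lborel (\<lambda>\<tau>. (C * D) * (pow_kernel p (t - \<tau>) * pow_kernel q \<tau>))"
      by (intro integrable_mult_right integrableI_nonneg)
         (auto simp: pow_kernel_conv[OF p(1) q(1)])
  qed (use bound p q in \<open>auto simp: abs_mult\<close>)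
qed

text \<open>
  The integrability needed for Fubini's theorem. By domination it suffices to treat three power
  kernels; integrating over \<open>\<tau>\<close> first merges two of them into one, and the remaining integral over
  \<open>\<sigma>\<close> is again a convolution of two power kernels.
\<close>

lemma integrable_triple_conv:
  assumes f: "f \<in> C_minus1" and g: "g \<in> C_minus1" and h: "h \<in> C_minus1"
  shows "integrable (lborel \<Otimes>\<^sub>M lborel)
           (\<lambda>(\<sigma>, \<tau>). zero_ext f (t - \<tau>) * zero_ext g (\<tau> - \<sigma>) * zero_ext h \<sigma>)"
proof -
  note [measurable] = measurable_zero_ext[OF f] measurable_zero_ext[OF g] measurable_zero_ext[OF h]
  obtain p C where p: "p > -1" "C \<ge> 0" "\<And>u. u \<le> t \<Longrightarrow> \<bar>zero_ext f u\<bar> \<le> C * pow_kernel p u"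
    using C_minus1_bound[OF f] by blast
  obtain q D where q: "q > -1" "D \<ge> 0" "\<And>u. u \<le> t \<Longrightarrow> \<bar>zero_ext g u\<bar> \<le> D * pow_kernel q u"
    using C_minus1_bound[OF g] by blast
  obtain r E where r: "r > -1" "E \<ge> 0" "\<And>u. u \<le> t \<Longrightarrow> \<bar>zero_ext h u\<bar> \<le> E * pow_kernel r u"
    using C_minus1_bound[OF h] by blast
  define K where "K = (\<lambda>\<sigma> \<tau>. pow_kernel p (t - \<tau>) * pow_kernel q (\<tau> - \<sigma>) * pow_kernel r \<sigma>)"
  have K0: "0 \<le> K \<sigma> \<tau>" for \<sigma> \<tau>
    by (simp add: K_def)
  \<comment> \<open>Outside \<open>0 < \<sigma> < \<tau> < t\<close> both sides vanish; inside, all three arguments are at most \<open>t\<close>,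
    as the bounds require.\<close>
  have bound: "\<bar>zero_ext f (t - \<tau>) * zero_ext g (\<tau> - \<sigma>) * zero_ext h \<sigma>\<bar>
      \<le> (C * D * E) * K \<sigma> \<tau>" for \<sigma> \<tau>
  proof (cases "0 < \<sigma> \<and> \<sigma> < \<tau> \<and> \<tau> < t")
    case True
    then have "\<bar>zero_ext f (t - \<tau>)\<bar> * \<bar>zero_ext g (\<tau> - \<sigma>)\<bar> * \<bar>zero_ext h \<sigma>\<bar>
        \<le> (C * pow_kernel p (t - \<tau>)) * (D * pow_kernel q (\<tau> - \<sigma>)) * (E * pow_kernel r \<sigma>)"
      using p q r by (intro mult_mono) auto
    then show ?thesis by (simp add: abs_mult mult_ac K_def)
  qed (auto simp: zero_ext_def K_def)
  have inner: "(\<integral>\<^sup>+\<tau>. ennreal (K \<sigma> \<tau>) \<partial>lborel)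
      = ennreal (Beta (q + 1) (p + 1)) *
        ennreal (pow_kernel (p + q + 1) (t - \<sigma>) * pow_kernel r \<sigma>)" for \<sigma>
  proof -
    have "(\<integral>\<^sup>+\<tau>. ennreal (K \<sigma> \<tau>) \<partial>lborel) =
       (\<integral>\<^sup>+\<tau>. ennreal (pow_kernel r \<sigma>) *
          ennreal (pow_kernel p (t - \<tau>) * pow_kernel q (\<tau> - \<sigma>)) \<partial>lborel)"
      by (intro nn_integral_cong) (simp add: K_def mult_ac flip: ennreal_mult')
    also have "\<dots> = ennreal (pow_kernel r \<sigma>) *
       (\<integral>\<^sup>+\<tau>. ennreal (pow_kernel p (t - \<tau>) * pow_kernel q (\<tau> - \<sigma>)) \<partial>lborel)"
      by (rule nn_integral_cmult) measurable
    also have "(\<integral>\<^sup>+\<tau>. ennreal (pow_kernel p (t - \<tau>) * pow_kernel q (\<tau> - \<sigma>)) \<partial>lborel)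
       = (\<integral>\<^sup>+\<tau>. ennreal (pow_kernel p ((t - \<sigma>) - \<tau>) * pow_kernel q \<tau>) \<partial>lborel)"
      by (subst nn_integral_real_affine[where c = 1 and t = \<sigma>]) (auto simp: algebra_simps)
    also have "\<dots> = ennreal (Beta (q + 1) (p + 1) * pow_kernel (p + q + 1) (t - \<sigma>))"
      by (rule pow_kernel_conv[OF p(1) q(1)])
    finally show ?thesis
      by (simp add: mult_ac ennreal_mult'')
  qed
  have "integrable (lborel \<Otimes>\<^sub>M lborel) (\<lambda>(\<sigma>, \<tau>). K \<sigma> \<tau>)"
  proof (rule integrableI_nonneg)
    show "(\<lambda>(\<sigma>, \<tau>). K \<sigma> \<tau>) \<in> borel_measurable (lborel \<Otimes>\<^sub>M lborel)"
      unfolding K_def by measurable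
    have "(\<integral>\<^sup>+x. ennreal (case x of (\<sigma>, \<tau>) \<Rightarrow> K \<sigma> \<tau>) \<partial>(lborel \<Otimes>\<^sub>M lborel))
        = (\<integral>\<^sup>+\<sigma>. (\<integral>\<^sup>+\<tau>. ennreal (K \<sigma> \<tau>) \<partial>lborel) \<partial>lborel)"
      by (subst lborel.nn_integral_fst[symmetric]) (auto simp: K_def)
    also have "\<dots> = ennreal (Beta (q + 1) (p + 1)) *
        (\<integral>\<^sup>+\<sigma>. ennreal (pow_kernel (p + q + 1) (t - \<sigma>) * pow_kernel r \<sigma>) \<partial>lborel)"
      unfolding inner by (rule nn_integral_cmult) measurable
    also have "\<dots> < \<infinity>"
      using p q r by (subst pow_kernel_conv) (auto simp: ennreal_mult_less_top)
    finally show "(\<integral>\<^sup>+x. ennreal (case x of (\<sigma>, \<tau>) \<Rightarrow> K \<sigma> \<tau>) \<partial>(lborel \<Otimes>\<^sub>M lborel)) < \<infinity>" .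
  qed (use K0 in auto)
  then have int: "integrable (lborel \<Otimes>\<^sub>M lborel) (\<lambda>x. (C * D * E) * (case x of (\<sigma>, \<tau>) \<Rightarrow> K \<sigma> \<tau>))"
    by (rule integrable_mult_right)
  show ?thesis
  proof (rule Bochner_Integration.integrable_bound[OF int])
    show "(\<lambda>(\<sigma>, \<tau>). zero_ext f (t - \<tau>) * zero_ext g (\<tau> - \<sigma>) * zero_ext h \<sigma>)
        \<in> borel_measurable (lborel \<Otimes>\<^sub>M lborel)"
      by measurable
    show "AE x in lborel \<Otimes>\<^sub>M lborel.
        norm (case x of (\<sigma>, \<tau>) \<Rightarrow> zero_ext f (t - \<tau>) * zero_ext g (\<tau> - \<sigma>) * zero_ext h \<sigma>)
        \<le> norm ((C * D * E) * (case x of (\<sigma>, \<tau>) \<Rightarrow> K \<sigma> \<tau>))"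
      unfolding real_norm_def
      by (intro AE_I2) (auto split: prod.split intro: order_trans[OF bound abs_ge_self])
  qed
qed

text \<open>
  Both sides are the integral of \<open>f (t - \<tau>) * g (\<tau> - \<sigma>) * h \<sigma>\<close> over \<open>0 < \<sigma> < \<tau> < t\<close>, taken in the
  two possible orders; the left-hand side needs the shift \<open>\<tau> \<mapsto> \<tau> + \<sigma>\<close> in the inner integral.
\<close>

lemma lconv_assoc:
  assumes f: "f \<in> C_minus1" and g: "g \<in> C_minus1" and h: "h \<in> C_minus1"
  shows "((f \<star> g) \<star> h) t = (f \<star> (g \<star> h)) t"
proof -
  let ?F = "zero_ext f" and ?G = "zero_ext g" and ?H = "zero_ext h"
  have "((f \<star> g) \<star> h) t = (\<integral>\<sigma>. (\<integral>\<tau>. ?F ((t - \<sigma>) - \<tau>) * ?G \<tau> \<partial>lborel) * ?H \<sigma> \<partial>lborel)"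
    by (simp only: lconv_zero_ext[of "f \<star> g" h t] zero_ext_lconv) (simp only: lconv_zero_ext)
  also have "\<dots> = (\<integral>\<sigma>. (\<integral>\<tau>. ?F (t - \<tau>) * ?G (\<tau> - \<sigma>) * ?H \<sigma> \<partial>lborel) \<partial>lborel)"
  proof (rule Bochner_Integration.integral_cong[OF refl])
    fix \<sigma> :: real
    have "(\<integral>\<tau>. ?F (t - \<tau>) * ?G (\<tau> - \<sigma>) \<partial>lborel)
        = (\<integral>\<tau>. ?F ((t - \<sigma>) - \<tau>) * ?G \<tau> \<partial>lborel)"
      by (subst lborel_integral_real_affine[where c = 1 and t = \<sigma>]) (auto simp: algebra_simps)
    then show "(\<integral>\<tau>. ?F ((t - \<sigma>) - \<tau>) * ?G \<tau> \<partial>lborel) * ?H \<sigma>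
        = (\<integral>\<tau>. ?F (t - \<tau>) * ?G (\<tau> - \<sigma>) * ?H \<sigma> \<partial>lborel)"
      by simp
  qed
  also have "\<dots> = (\<integral>\<tau>. (\<integral>\<sigma>. ?F (t - \<tau>) * ?G (\<tau> - \<sigma>) * ?H \<sigma> \<partial>lborel) \<partial>lborel)"
    by (rule lborel_pair.Fubini_integral[symmetric, OF integrable_triple_conv[OF f g h]])
  also have "\<dots> = (\<integral>\<tau>. ?F (t - \<tau>) * (\<integral>\<sigma>. ?G (\<tau> - \<sigma>) * ?H \<sigma> \<partial>lborel) \<partial>lborel)"
    by (simp add: mult.assoc)
  also have "\<dots> = (f \<star> (g \<star> h)) t"
    by (simp only: lconv_zero_ext[of f "g \<star> h" t] zero_ext_lconv) (simp only: lconv_zero_ext)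
  finally show ?thesis .
qed

section \<open>Convolution with the constant 1 as integration\<close>

lemma C_minus1_continuous: "continuous_on {0..} g \<Longrightarrow> g \<in> C_minus1"
  unfolding C_minus1_def by (intro CollectI exI[of _ 0] exI[of _ g]) simp

lemma one_pow_C_minus1:
  assumes "k \<ge> 1"
  shows "one_pow k \<in> C_minus1"
proof -
  have "continuous_on {0..} (\<lambda>t :: real. t ^ (k - 1) / fact (k - 1))"
    by (intro continuous_intros) simp
  from C_minus1_cong[OF C_minus1_continuous[OF this]] show ?thesis
    by (simp only: one_pow_eq[OF assms])
qed

lemma const_C_minus1: "(\<lambda>_. c) \<in> C_minus1"
  by (rule C_minus1_continuous) (rule continuous_on_const)

lemma integrable_zero_ext:
  assumes "f \<in> C_minus1"
  shows "zero_ext f integrable_on {0..T}"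
proof -
  \<comment> \<open>Convolving with \<open>1\<close> at \<open>T + 1\<close> rather than at \<open>T\<close> makes the first factor equal to \<open>1\<close> on all
    of \<open>{0..T}\<close>, the right end point included.\<close>
  have "integrable lborel (\<lambda>\<tau>. zero_ext (\<lambda>_. 1) ((T + 1) - \<tau>) * zero_ext f \<tau>)"
    by (rule integrable_lconv[OF const_C_minus1 assms])
  then have "(\<lambda>\<tau>. zero_ext (\<lambda>_. 1) ((T + 1) - \<tau>) * zero_ext f \<tau>) integrable_on {0..T}"
    by (intro integrable_on_subinterval[OF integrable_on_lborel]) auto
  then show ?thesis
    by (rule integrable_eq) (auto simp: zero_ext_def)
qed

lemma lconv_one:
  assumes f: "f \<in> C_minus1" and t: "t \<ge> 0"
  shows "((\<lambda>_. 1) \<star> f) t = integral {0..t} (zero_ext f)"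
proof -
  let ?g = "\<lambda>\<tau>. zero_ext (\<lambda>_. 1) (t - \<tau>) * zero_ext f \<tau>"
  have "integrable lborel ?g"
    by (rule integrable_lconv[OF const_C_minus1 f])
  then have "(?g has_integral ((\<lambda>_. 1) \<star> f) t) UNIV"
    unfolding lconv_zero_ext by (rule has_integral_integral_lborel)
  moreover have "(\<lambda>\<tau>. if \<tau> \<in> {0<..<t} then zero_ext f \<tau> else 0) = ?g"
    by (auto simp: zero_ext_def)
  ultimately have "(zero_ext f has_integral ((\<lambda>_. 1) \<star> f) t) {0<..<t}"
    by (subst has_integral_restrict_UNIV[symmetric]) simp
  then show ?thesis
    by (simp add: integral_unique flip: has_integral_Icc_iff_Ioo)
qed

text \<open>
  The primitive is continuous up to and including \<open>0\<close> even if \<open>f\<close> is unbounded there, so it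
  belongs to the space with exponent \<open>0\<close>.
\<close>

lemma lconv_one_C_minus1:
  assumes f: "f \<in> C_minus1"
  shows "(\<lambda>_. 1) \<star> f \<in> C_minus1"
proof (rule C_minus1_cong[OF C_minus1_continuous])
  let ?I = "\<lambda>t. integral {0..t} (zero_ext f)"
  show "continuous_on {0..} ?I"
    unfolding continuous_on_eq_continuous_within
  proof
    fix x :: real assume x: "x \<in> {0..}"
    have "continuous_on {0..x + 1} ?I"
      by (rule indefinite_integral_continuous_1[OF integrable_zero_ext[OF f]])
    then have "continuous (at x within {0..x + 1}) ?I"
      using x by (simp add: continuous_on_eq_continuous_within)
    moreover have "at x within {0..x + 1} = at x within {0..}"
      by (rule at_within_nhd[where S = "{..<x + 1}"]) auto
    ultimately show "continuous (at x within {0..}) ?I" by simp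
  qed
qed (simp add: lconv_one[OF f])

lemma lconv_one_deriv:
  assumes f: "f \<in> C_minus1" and t: "t > 0"
  shows "((\<lambda>_. 1) \<star> f has_field_derivative f t) (at t)"
proof -
  have "continuous_on {0<..} (zero_ext f)"
    using continuous_on_C_minus1[OF f] by (rule continuous_on_eq) (auto simp: zero_ext_def)
  then have "isCont (zero_ext f) t"
    using t by (simp add: continuous_on_eq_continuous_at)
  then have "((\<lambda>u. integral {0..u} (zero_ext f)) has_vector_derivative zero_ext f t)
               (at t within ({0..t + 1} - {}))"
    using t by (intro integral_has_vector_derivative_continuous_at integrable_zero_ext[OF f])
               (auto intro: continuous_at_imp_continuous_at_within)
  moreover have "at t within ({0..t + 1} - {}) = at t"
    using t by (intro at_within_interior) auto
  ultimately have "((\<lambda>u. integral {0..u} (zero_ext f)) has_field_derivative f t) (at t)"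
    using t by (simp add: has_real_derivative_iff_has_vector_derivative zero_ext_def)
  then show ?thesis
    by (rule has_field_derivative_transform_within_open[where S = "{0<..}"])
       (use t lconv_one[OF f] in auto)
qed

section \<open>Iterated derivatives\<close>

text \<open>
  The induction generalises over \<open>f\<close>: the extra factor \<open>1\<close> of \<open>{1}\<^bsup>k+1\<^esup>\<close> is moved to \<open>f\<close> by
  associativity. Then \<open>k\<close> derivatives reach the primitive \<open>1 \<star> f\<close>, and one more reaches \<open>f\<close>. In
  this way no derivative of a convolution with a nonconstant kernel has to be computed.
\<close>

lemma one_pow_lconv_deriv:
  assumes "k \<ge> 1" and "f \<in> C_minus1"
  shows "(\<forall>j<k. \<forall>t>0. (deriv ^^ j) (one_pow k \<star> f) field_differentiable at t) \<and>
         (\<forall>t>0. (deriv ^^ k) (one_pow k \<star> f) t = f t)"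
  using assms
proof (induction k arbitrary: f rule: nat_induct_at_least)
  case base
  have "one_pow 1 = (\<lambda>_. 1)" by (simp add: one_pow_def)
  with lconv_one_deriv[OF base] show ?case
    by (auto simp: field_differentiable_def intro: DERIV_imp_deriv)
next
  case (Suc k)
  define Z where "Z = (\<lambda>_. 1) \<star> f"
  have Z: "Z \<in> C_minus1"
    unfolding Z_def by (rule lconv_one_C_minus1[OF Suc.prems])
  have dZ: "(Z has_field_derivative f t) (at t)" if "t > 0" for t
    unfolding Z_def by (rule lconv_one_deriv[OF Suc.prems that])
  note IH = Suc.IH[OF Z]
  obtain i where "k = Suc i"
    using Suc.hyps by (cases k) auto
  then have "one_pow (Suc k) = one_pow k \<star> (\<lambda>_. 1)"
    by (simp add: one_pow_def)
  then have "one_pow (Suc k) \<star> f = one_pow k \<star> Z"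
    unfolding Z_def
    by (intro ext) (simp add: lconv_assoc one_pow_C_minus1[OF Suc.hyps] const_C_minus1 Suc.prems)
  moreover have "((deriv ^^ k) (one_pow k \<star> Z) has_field_derivative f t) (at t)" if "t > 0" for t
    by (rule has_field_derivative_transform_within_open[OF dZ[OF that], where S = "{0<..}"])
       (use IH that in auto)
  ultimately show ?case
    using IH by (auto simp: less_Suc_eq field_differentiable_def intro: DERIV_imp_deriv)
qed

section \<open>The fractional derivative as left inverse of the fractional integral\<close>

lemma gfd_RL_gfi:
  assumes pair: "(M, N) \<in> luchko_set n" and n: "n \<ge> 1" and Y: "Y \<in> C_minus1"
    and X: "\<And>t. t > 0 \<Longrightarrow> X t = gfi M Y t"
  shows "gfd_RL_exists n N X \<and> (\<forall>t>0. gfd_RL n N X t = Y t)"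
proof -
  have M: "M \<in> C_minus1" and N: "N \<in> C_minus1"
    and MN: "\<And>t. t > 0 \<Longrightarrow> (M \<star> N) t = one_pow n t"
    using pair unfolding luchko_set_def by auto
  have "N \<star> X = N \<star> (M \<star> Y)"
    using X by (intro lconv_cong) (auto simp: gfi_def)
  also have "\<dots> = (N \<star> M) \<star> Y"
    by (intro ext) (simp add: lconv_assoc[OF N M Y])
  also have "\<dots> = one_pow n \<star> Y"
    using MN by (intro lconv_cong) (auto simp: lconv_commute[of N M])
  finally show ?thesis
    using one_pow_lconv_deriv[OF n Y] by (simp add: gfd_RL_exists_def gfd_RL_def)
qed

text \<open>
  On the range of the integral, a left inverse is also a right inverse: the derivative recovers
  \<open>Y\<close> from \<open>X = M \<star> Y\<close>, and integrating \<open>Y\<close> again gives \<open>X\<close>. The derivative agrees with \<open>Y\<close> only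
  for \<open>t > 0\<close>, which suffices because neither membership in the space nor convolution inspects
  other values.
\<close>

theorem theorem9:
  fixes n m l :: nat and M N X :: "real \<Rightarrow> real"
  assumes "1 \<le> m" and "m \<le> n - 1"
    and "m + 1 \<le> l" and "l \<le> n - 1"
    and "(M, N) \<in> luchko_T3 n m l"
    and "X \<in> C_minus1_gfi M"
  shows "gfd_RL_exists n N X \<and> gfd_RL n N X \<in> C_minus1 \<and>
         (\<forall>t>0. gfi M (gfd_RL n N X) t = X t)"
proof -
  have pair: "(M, N) \<in> luchko_set n"
    using assms(5) unfolding luchko_T3_def by auto
  have n: "n \<ge> 1"
    using assms(1,2) by simp
  obtain Y where Y: "Y \<in> C_minus1" and X: "\<And>t. t > 0 \<Longrightarrow> X t = gfi M Y t"
    using assms(6) unfolding C_minus1_gfi_def by auto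
  note D = gfd_RL_gfi[OF pair n Y X]
  have "gfd_RL n N X \<in> C_minus1"
    by (rule C_minus1_cong[OF Y]) (use D in simp)
  moreover have "gfi M (gfd_RL n N X) = gfi M Y"
    unfolding gfi_def by (rule lconv_cong) (use D in auto)
  ultimately show ?thesis
    using D X by simp
qed

end
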